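(* Let $f\ge k_{\rm tt}/k_{\rm nt}$ (with $k_{\rm nt}>0$), $\mathbf u_0=\mathbf 0$, $R>0$, and let $\mathbf F:[0,2]\to\mathbb R^2$ be the Lipschitz-continuous function $$\mathbf F(s)=\begin{cases}(sR/f,\ sR)&\text{if }s\in[0,1],\\ \bigl(R/f+(s-1),\ R+(f+1)(s-1)\bigr)&\text{if }s\in[1,2].\end{cases}$$ Then the function $\mathbf u$ defined by $\mathbf u(s)=\mathbf 0$ for $s\in[0,1[$ and $$\mathbf u(s)=\left(\frac{R(k_{\rm tt}/f-k_{\rm nt})+[k_{\rm tt}-k_{\rm nt}(f+1)](s-1)}{k_{\rm nn}k_{\rm tt}-k_{\rm nt}^2},\ \frac{R(k_{\rm nn}-k_{\rm nt}/f)+[k_{\rm nn}(f+1)-k_{\rm nt}](s-1)}{k_{\rm nn}k_{\rm tt}-k_{\rm nt}^2}\right)$$ for $s\in[1,2]$ is the only solution of the discrete quasi-static problem on $[0,2]$ with external force $\mathbf F$ and initial condition $\mathbf u_0$ that equals $\mathbf 0$ for $s\in[0,1[$.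
   Context: Vectors of $\mathbb R^2$ are written $(x_{\rm n},x_{\rm t})$. $\mathbf K=\begin{pmatrix}k_{\rm nn}&k_{\rm nt}\\k_{\rm nt}&k_{\rm tt}\end{pmatrix}$ is a positive definite symmetric matrix with $k_{\rm nt}\ge0$, and $f\ge0$ is the friction coefficient. $BV^+([0,S];\mathbb R^2)$ is the space of right-continuous functions of bounded variation on $[0,S]$ (conventions $\mathbf u(0-)=\mathbf u(0)$, $\mathbf u(S+)=\mathbf u(S)$); for $u$ in it, $\dot u$ is the Stieltjes measure, $\dot u([s_1,s_2])=u(s_2+)-u(s_1-)$. $\mathbf u_0\in\mathbb R^2$ is admissible with respect to $\mathbf F\in\mathbb R^2$ if there is $\mathbf t\in\mathbb R^2$ with $\mathbf K\mathbf u_0=\mathbf F+\mathbf t$, $u_{0\rm n}\le0$, $t_{\rm n}\le0$, $u_{0\rm n}t_{\rm n}=0$, $|t_{\rm t}|\le-ft_{\rm n}$. Discrete quasi-static problem: given $\mathbf F\in BV^+([0,S];\mathbb R^2)$ and $\mathbf u_0$ admissible with respect to $\mathbf F(0)$, $\mathbf u,\mathbf t\in BV^+([0,S];\mathbb R^2)$ is a solution (and $\mathbf u$ is then also called a solution, $\mathbf t=\mathbf K\mathbf u-\mathbf F$ being determined by it) if $\mathbf u(0)=\mathbf u_0$ and, for all $s\in[0,S]$: $\mathbf K\mathbf u(s)=\mathbf F(s)+\mathbf t(s)$; $u_{\rm n}(s)\le0$, $t_{\rm n}(s)\le0$, $u_{\rm n}(s)t_{\rm n}(s)=0$; $|t_{\rm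 t}(s)|\le-ft_{\rm n}(s)$; and, as measures on $[0,S]$, $t_{\rm t}\dot u_{\rm t}=ft_{\rm n}|\dot u_{\rm t}|$, where $|\dot u_{\rm t}|$ is the total variation measure of $\dot u_{\rm t}$. *)

theory Defs
  imports "HOL-Analysis.Analysis"
begin

section \<open>Right-continuous functions of bounded variation\<close>

definition variation_sum :: "(real \<Rightarrow> 'a::real_normed_vector) \<Rightarrow> real list \<Rightarrow> real" where
  "variation_sum g xs = (\<Sum>i<length xs - 1. norm (g (xs ! Suc i) - g (xs ! i)))"

definition partitions :: "real \<Rightarrow> real \<Rightarrow> real list set" where
  "partitions a b = {xs. sorted xs \<and> set xs \<subseteq> {a..b}}"

definition bounded_variation :: "real \<Rightarrow> real \<Rightarrow> (real \<Rightarrow> 'a::real_normed_vector) \<Rightarrow> bool" where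
  "bounded_variation a b g \<longleftrightarrow> bdd_above (variation_sum g ` partitions a b)"

definition variation :: "real \<Rightarrow> real \<Rightarrow> (real \<Rightarrow> 'a::real_normed_vector) \<Rightarrow> real" where
  "variation a b g = (SUP xs\<in>partitions a b. variation_sum g xs)"

text \<open>
  Functions on \<open>[0, S]\<close> are total functions whose values outside \<open>[0, S]\<close> are irrelevant.
  The convention \<open>g (S+) = g S\<close> is why right-continuity is only required on \<open>[0, S[\<close>.
\<close>

definition BV_plus :: "real \<Rightarrow> (real \<Rightarrow> 'a::real_normed_vector) set" where
  "BV_plus S = {g. bounded_variation 0 S g \<and> (\<forall>s\<in>{0..<S}. continuous (at_right s) g)}"


section \<open>Signed measures\<close>

text \<open>
  A finite signed measure on the measurable space \<open>M\<close> (only \<open>space M\<close> and \<open>sets M\<close> are used) is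
  represented by a real-valued set function.  Since \<open>\<mu> {} = 0\<close>, the truncation of negative values
  by \<^const>\<open>ennreal\<close> does not affect the supremum.
\<close>

definition upper_variation :: "'a measure \<Rightarrow> ('a set \<Rightarrow> real) \<Rightarrow> 'a measure" where
  "upper_variation M \<mu> =
     measure_of (space M) (sets M) (\<lambda>A. SUP B\<in>{B \<in> sets M. B \<subseteq> A}. ennreal (\<mu> B))"

definition lower_variation :: "'a measure \<Rightarrow> ('a set \<Rightarrow> real) \<Rightarrow> 'a measure" where
  "lower_variation M \<mu> = upper_variation M (\<lambda>A. - \<mu> A)"

definition total_variation_measure :: "'a measure \<Rightarrow> ('a set \<Rightarrow> real) \<Rightarrow> 'a measure" where
  "total_variation_measure M \<mu> =
     measure_of (space M) (sets M)
       (\<lambda>A. emeasure (upper_variation M \<mu>) A + emeasure (lower_variation M \<mu>) A)"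

definition signed_set_integral ::
    "'a measure \<Rightarrow> ('a set \<Rightarrow> real) \<Rightarrow> 'a set \<Rightarrow> ('a \<Rightarrow> real) \<Rightarrow> real" where
  "signed_set_integral M \<mu> A h =
     (LINT x:A|upper_variation M \<mu>. h x) - (LINT x:A|lower_variation M \<mu>. h x)"


section \<open>The Stieltjes measure\<close>

definition clamp_to :: "real \<Rightarrow> real \<Rightarrow> real" where
  "clamp_to S x = max 0 (min S x)"

text \<open>
  The signed Stieltjes measure of \<open>g\<close> on \<open>[0, S]\<close>, obtained by writing \<open>g = V - (V - g)\<close> with \<open>V\<close>
  the variation function of \<open>g\<close>; \<open>V\<close> and \<open>V - g\<close> are nondecreasing and right-continuous.
  Constant extension to the real line encodes the conventions \<open>g (0-) = g 0\<close> and
  \<open>g (S+) = g S\<close>.  Lemma \<open>stieltjes_Icc\<close> below shows that this is the intended measure.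
\<close>

definition stieltjes :: "real \<Rightarrow> (real \<Rightarrow> real) \<Rightarrow> real set \<Rightarrow> real" where
  "stieltjes S g A =
     measure (interval_measure (\<lambda>x. variation 0 (clamp_to S x) g)) A -
     measure (interval_measure (\<lambda>x. variation 0 (clamp_to S x) g - g (clamp_to S x))) A"

lemma variation_sum_simps [simp]:
  "variation_sum g [] = 0"
  "variation_sum g [x] = 0"
  "variation_sum g (x # y # zs) = norm (g y - g x) + variation_sum g (y # zs)"
  by (simp_all add: variation_sum_def sum.lessThan_Suc_shift del: sum.lessThan_Suc)

lemma variation_sum_nonneg: "0 \<le> variation_sum g xs"
  unfolding variation_sum_def by (intro sum_nonneg) auto

lemma variation_sum_append_ge:
  "variation_sum g xs + variation_sum g ys \<le> variation_sum g (xs @ ys)"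
proof (induction xs rule: induct_list012)
  case (2 x)
  then show ?case by (cases ys) auto
qed auto

lemma variation_sum_append_le:
  "variation_sum g (xs @ ys) \<le> variation_sum g (xs @ [s]) + variation_sum g (s # ys)"
proof (induction xs rule: induct_list012)
  case 1
  then show ?case by (cases ys) auto
next
  case (2 x)
  then show ?case
    by (cases ys) (use norm_triangle_ineq[of "g s - g x" "g (hd ys) - g s"] in auto)
qed auto

lemma variation_sum_change_hd:
  "variation_sum g (s # ys) \<le> norm (g x - g s) + variation_sum g (x # ys)"
  by (cases ys) (use norm_triangle_ineq[of "g x - g s" "g (hd ys) - g x"] in auto)

lemma variation_sum_const:
  assumes "\<And>x. x \<in> set xs \<Longrightarrow> x = s"
  shows "variation_sum g xs = 0"
proof -
  have "xs = replicate (length xs) s"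
    using assms by (simp add: replicate_length_same)
  moreover have "variation_sum g (replicate n s) = 0" for n
    by (simp add: variation_sum_def)
  ultimately show ?thesis by metis
qed

lemma sorted_split_filter:
  assumes "sorted xs"
  shows "filter (\<lambda>y. y \<le> s) xs @ filter (\<lambda>y. s < y) (xs :: real list) = xs"
  using assms
proof (induction xs)
  case (Cons x xs)
  show ?case
  proof (cases "x \<le> s")
    case True
    then show ?thesis using Cons by simp
  next
    case False
    then have "\<forall>y\<in>set (x # xs). s < y" using Cons.prems by auto
    then show ?thesis by (simp add: filter_empty_conv not_le filter_True)
  qed
qed simp

lemma partitions_mono: "a' \<le> a \<Longrightarrow> b \<le> b' \<Longrightarrow> partitions a b \<subseteq> partitions a' b'"
  by (auto simp: partitions_def)

lemma partitions_Nil [simp]: "[] \<in> partitions a b"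
  by (simp add: partitions_def)

lemma bounded_variation_mono:
  "bounded_variation a' b' g \<Longrightarrow> a' \<le> a \<Longrightarrow> b \<le> b' \<Longrightarrow> bounded_variation a b g"
  unfolding bounded_variation_def by (meson bdd_above_mono image_mono partitions_mono)

lemma variation_upper:
  "bounded_variation a b g \<Longrightarrow> xs \<in> partitions a b \<Longrightarrow> variation_sum g xs \<le> variation a b g"
  unfolding bounded_variation_def variation_def by (rule cSUP_upper)

lemma variation_least:
  "(\<And>xs. xs \<in> partitions a b \<Longrightarrow> variation_sum g xs \<le> c) \<Longrightarrow> variation a b g \<le> c"
  unfolding variation_def by (rule cSUP_least) (auto intro: partitions_Nil)

lemma variation_increment:
  assumes "bounded_variation 0 S g" "0 \<le> x" "x \<le> y" "y \<le> S"
  shows "norm (g y - g x) \<le> variation 0 y g - variation 0 x g"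
proof -
  have "variation 0 x g \<le> variation 0 y g - norm (g y - g x)"
  proof (rule variation_least)
    fix xs assume xs: "xs \<in> partitions 0 x"
    have "xs @ [x, y] \<in> partitions 0 y"
      using xs assms by (fastforce simp: partitions_def sorted_append)
    moreover have "bounded_variation 0 y g"
      using assms bounded_variation_mono by fastforce
    ultimately have "variation_sum g (xs @ [x, y]) \<le> variation 0 y g"
      by (intro variation_upper)
    with variation_sum_append_ge[of g xs "[x, y]"]
    show "variation_sum g xs \<le> variation 0 y g - norm (g y - g x)" by simp
  qed
  then show ?thesis by simp
qed

lemma variation_right_bound:
  assumes bv: "bounded_variation 0 S g" and s: "0 \<le> s" "s < S"
    and cont: "continuous (at_right s) g" and e: "0 < e"
  shows "eventually (\<lambda>x. variation 0 x g \<le> variation 0 s g + e) (at_right s)"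
proof -
  have bvS: "bounded_variation s S g" and bvs: "bounded_variation 0 s g"
    using bv s by (auto intro: bounded_variation_mono)
  have "variation s S g - e / 2 < variation s S g" using e by simp
  then obtain q where q: "q \<in> partitions s S"
    and q_gt: "variation s S g - e / 2 < variation_sum g q"
    using bvS less_cSUP_iff[of "partitions s S" "variation_sum g"]
    unfolding bounded_variation_def variation_def by (metis emptyE partitions_Nil)
  define q' where "q' = filter (\<lambda>y. s < y) q"
  define m where "m = Min (insert S (set q'))"
  have m: "s < m" "m \<le> S" "\<And>y. y \<in> set q' \<Longrightarrow> m \<le> y"
    using s by (auto simp: m_def q'_def)
  have "(g \<longlongrightarrow> g s) (at_right s)"
    using cont by (simp add: continuous_within)
  then have "eventually (\<lambda>x. dist (g x) (g s) < e / 2) (at_right s)"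
    using e by (intro tendstoD) auto
  moreover have "eventually (\<lambda>x. x \<in> {s<..<m}) (at_right s)"
    using m(1) by (rule eventually_at_right_real)
  ultimately show ?thesis
  proof eventually_elim
    case (elim x)
    have "variation_sum g q \<le>
        variation_sum g (filter (\<lambda>y. y \<le> s) q @ [s]) + variation_sum g (s # q')"
      using q sorted_split_filter[of q s] variation_sum_append_le[of g "filter (\<lambda>y. y \<le> s) q" q' s]
      by (simp add: partitions_def q'_def)
    also have "variation_sum g (filter (\<lambda>y. y \<le> s) q @ [s]) = 0"
      using q by (intro variation_sum_const[of _ s]) (force simp: partitions_def)
    also have "variation_sum g (s # q') \<le> norm (g x - g s) + variation_sum g (x # q')"
      by (rule variation_sum_change_hd)
    finally have 1: "variation_sum g q \<le> norm (g x - g s) + variation_sum g (x # q')" by simp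
    show ?case
    proof (rule variation_least)
      fix p assume p: "p \<in> partitions 0 x"
      define p' where "p' = filter (\<lambda>y. s < y) p"
      define p0 where "p0 = filter (\<lambda>y. y \<le> s) p"
      have "p0 @ p' = p"
        using p sorted_split_filter[of p s] by (simp add: partitions_def p0_def p'_def)
      then have 2: "variation_sum g p \<le> variation_sum g (p0 @ [s]) + variation_sum g (s # p')"
        using variation_sum_append_le by metis
      have "p0 @ [s] \<in> partitions 0 s"
        using p s by (auto simp: partitions_def p0_def sorted_append sorted_wrt_filter)
      then have 3: "variation_sum g (p0 @ [s]) \<le> variation 0 s g"
        by (rule variation_upper[OF bvs])
      have mem: "(s # p') @ (x # q') \<in> partitions s S"
      proof -
        have "sorted p'" "sorted q'" "\<forall>y\<in>set p'. s \<le> y \<and> y \<le> x" "\<forall>y\<in>set q'. x \<le> y \<and> y \<le> S"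
          using p q elim(2) m(3) by (fastforce simp: partitions_def p'_def q'_def sorted_wrt_filter)+
        then show ?thesis
          using elim(2) m(2) s by (fastforce simp: partitions_def sorted_append)
      qed
      have "variation_sum g (s # p') + variation_sum g (x # q') \<le> variation s S g"
        using variation_sum_append_ge[of g "s # p'" "x # q'"] variation_upper[OF bvS mem] by linarith
      with 1 2 3 q_gt elim(1) show "variation_sum g p \<le> variation 0 s g + e"
        by (simp add: dist_norm)
    qed
  qed
qed

lemma clamp_to_bounds: "0 \<le> S \<Longrightarrow> 0 \<le> clamp_to S x \<and> clamp_to S x \<le> S"
  by (auto simp: clamp_to_def)

lemma clamp_to_mono: "x \<le> y \<Longrightarrow> clamp_to S x \<le> clamp_to S y"
  by (auto simp: clamp_to_def)

lemma continuous_right_clamp: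
  fixes h :: "real \<Rightarrow> 'a::real_normed_vector"
  assumes "0 \<le> S" and cont: "\<And>s. s \<in> {0..<S} \<Longrightarrow> continuous (at_right s) h"
  shows "continuous (at_right a) (\<lambda>x. h (clamp_to S x))"
proof -
  have ev: "continuous (at_right a) (\<lambda>x. h (clamp_to S x))"
    if "eventually (\<lambda>x. h (clamp_to S x) = k x) (at_right a)" "h (clamp_to S a) = k a"
      "continuous (at_right a) k" for k
    using that unfolding continuous_within by (simp add: tendsto_cong)
  consider "a < 0" | "0 \<le> a" "a < S" | "S \<le> a" by linarith
  then show ?thesis
  proof cases
    case 1
    have "eventually (\<lambda>x. x \<in> {a<..<0}) (at_right a)"
      using 1 by (rule eventually_at_right_real)
    then show ?thesis
      using 1 assms(1) by (intro ev[of "\<lambda>_. h 0"]) (auto elim!: eventually_mono simp: clamp_to_def)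
  next
    case 2
    have "eventually (\<lambda>x. x \<in> {a<..<S}) (at_right a)"
      using 2(2) by (rule eventually_at_right_real)
    then show ?thesis
      using 2 by (intro ev[of h]) (auto elim!: eventually_mono simp: clamp_to_def intro!: cont)
  next
    case 3
    have "eventually (\<lambda>x. x \<in> {a<..<a + 1}) (at_right a)"
      by (rule eventually_at_right_real) simp
    then show ?thesis
      using 3 assms(1) by (intro ev[of "\<lambda>_. h S"]) (auto elim!: eventually_mono simp: clamp_to_def)
  qed
qed

lemma continuous_right_variation:
  assumes g: "g \<in> BV_plus S" and s: "s \<in> {0..<S}"
  shows "continuous (at_right s) (\<lambda>x. variation 0 x g)"
  unfolding continuous_within
proof (rule tendstoI)
  fix e :: real assume e: "0 < e"
  have bv: "bounded_variation 0 S g" using g by (simp add: BV_plus_def)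
  have "eventually (\<lambda>x. variation 0 x g \<le> variation 0 s g + e / 2) (at_right s)"
    using g s e by (intro variation_right_bound[of S]) (auto simp: BV_plus_def)
  moreover have "eventually (\<lambda>x. x \<in> {s<..<S}) (at_right s)"
    using s by (intro eventually_at_right_real) simp
  ultimately show "eventually (\<lambda>x. dist (variation 0 x g) (variation 0 s g) < e) (at_right s)"
  proof eventually_elim
    case (elim x)
    have "0 \<le> variation 0 x g - variation 0 s g"
      using variation_increment[OF bv, of s x] elim s
      by (smt (verit) atLeastLessThan_iff greaterThanLessThan_iff norm_ge_zero)
    then show ?case using elim e by (simp add: dist_real_def)
  qed
qed

lemma interval_measure_Icc_limit:
  fixes G :: "real \<Rightarrow> real"
  assumes mono: "\<And>x y. x \<le> y \<Longrightarrow> G x \<le> G y" and cont: "\<And>a. continuous (at_right a) G"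
    and ab: "a \<le> b"
  shows "(\<lambda>n. G b - G (a - 1 / Suc n)) \<longlonglongrightarrow> measure (interval_measure G) {a..b}"
proof -
  define c where "c n = a - 1 / real (Suc n)" for n
  have c_less: "c n < a" for n by (simp add: c_def)
  have "1 / real (Suc (Suc n)) \<le> 1 / real (Suc n)" for n by (rule divide_left_mono) auto
  then have c_Suc: "c n \<le> c (Suc n)" for n by (simp only: c_def diff_left_mono)
  have "(\<lambda>n. c n) \<longlonglongrightarrow> a - 0"
    unfolding c_def by (intro tendsto_diff tendsto_const LIMSEQ_Suc lim_1_over_n)
  then have c_lim: "c \<longlonglongrightarrow> a" by simp
  have "(\<lambda>n. measure (interval_measure G) {c n<..b}) \<longlonglongrightarrow>
      measure (interval_measure G) (\<Inter>n. {c n<..b})"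
  proof (rule Lim_measure_decseq)
    show "range (\<lambda>n. {c n<..b}) \<subseteq> sets (interval_measure G)" by auto
    show "decseq (\<lambda>n. {c n<..b})"
      using le_less_trans[OF c_Suc] by (intro decseq_SucI) auto
    show "emeasure (interval_measure G) {c n<..b} \<noteq> \<infinity>" for n
      using emeasure_interval_measure_Ioc_eq[of G, OF mono cont] by simp
  qed
  also have "(\<Inter>n. {c n<..b}) = {a..b}"
  proof (intro equalityI subsetI)
    fix x assume x: "x \<in> (\<Inter>n. {c n<..b})"
    then have "c n \<le> x" for n by (auto intro: less_imp_le)
    then have "a \<le> x" using c_lim LIMSEQ_le_const2 by blast
    then show "x \<in> {a..b}" using x by auto
  next
    fix x assume "x \<in> {a..b}"
    then show "x \<in> (\<Inter>n. {c n<..b})"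
      using c_less by (auto intro: less_le_trans)
  qed
  also have "(\<lambda>n. measure (interval_measure G) {c n<..b}) = (\<lambda>n. G b - G (c n))"
    using ab c_less
    by (intro ext measure_interval_measure_Ioc[OF _ mono cont]) (meson less_imp_le order_trans)
  finally show ?thesis by (simp only: c_def)
qed

lemma stieltjes_Icc:
  assumes g: "g \<in> BV_plus S" and s: "0 \<le> s1" "s1 \<le> s2" "s2 \<le> S"
    and l: "((\<lambda>x. g (clamp_to S x)) \<longlongrightarrow> l) (at_left s1)"
  shows "stieltjes S g {s1..s2} = g s2 - l"
proof -
  let ?V = "\<lambda>x. variation 0 (clamp_to S x) g"
  let ?W = "\<lambda>x. variation 0 (clamp_to S x) g - g (clamp_to S x)"
  have bv: "bounded_variation 0 S g" and S: "0 \<le> S" using g s by (auto simp: BV_plus_def)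
  have inc: "norm (g (clamp_to S y) - g (clamp_to S x)) \<le> ?V y - ?V x" if "x \<le> y" for x y
    using variation_increment[OF bv] clamp_to_bounds[OF S] clamp_to_mono[OF that] by blast
  have V: "?V x \<le> ?V y" "?W x \<le> ?W y" if "x \<le> y" for x y
    using inc[OF that] by (auto simp: real_norm_def)
  have gc: "continuous (at_right a) g" if "a \<in> {0..<S}" for a
    using g that by (auto simp: BV_plus_def)
  have cV: "continuous (at_right a) ?V" for a
    by (rule continuous_right_clamp[OF S]) (rule continuous_right_variation[OF g])
  have cW: "continuous (at_right a) ?W" for a
    using S gc by (intro continuous_diff cV continuous_right_clamp) auto
  have "(\<lambda>n. (?V s2 - ?V (s1 - 1 / Suc n)) - (?W s2 - ?W (s1 - 1 / Suc n)))
      \<longlonglongrightarrow> stieltjes S g {s1..s2}"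
    unfolding stieltjes_def
    by (intro tendsto_diff interval_measure_Icc_limit V cV cW s)
  then have lim1: "(\<lambda>n. g s2 - g (clamp_to S (s1 - 1 / Suc n))) \<longlonglongrightarrow> stieltjes S g {s1..s2}"
    using s by (simp add: clamp_to_def)
  have "(\<lambda>n. s1 - 1 / Suc n) \<longlonglongrightarrow> s1 - 0"
    by (intro tendsto_diff tendsto_const LIMSEQ_Suc lim_1_over_n)
  then have "filterlim (\<lambda>n. s1 - 1 / Suc n) (at_left s1) sequentially"
    unfolding filterlim_at by auto
  then have "(\<lambda>n. g s2 - g (clamp_to S (s1 - 1 / Suc n))) \<longlonglongrightarrow> g s2 - l"
    by (intro tendsto_diff tendsto_const filterlim_compose[OF l])
  then show ?thesis using lim1 LIMSEQ_unique by blast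
qed


section \<open>The discrete quasi-static problem with friction\<close>

text \<open>
  In \<^typ>\<open>real^2\<close> component 1 is the normal and component 2 the tangential one, so
  \<open>K $ 1 $ 1\<close>, \<open>K $ 1 $ 2\<close>, \<open>K $ 2 $ 2\<close> are the coefficients \<open>k\<^sub>n\<^sub>n\<close>, \<open>k\<^sub>n\<^sub>t\<close>, \<open>k\<^sub>t\<^sub>t\<close>.
\<close>

definition stiffness_matrix :: "real^2^2 \<Rightarrow> bool" where
  "stiffness_matrix K \<longleftrightarrow>
     transpose K = K \<and> (\<forall>x. x \<noteq> 0 \<longrightarrow> 0 < x \<bullet> (K *v x)) \<and> 0 \<le> K $ 1 $ 2"

definition admissible :: "real^2^2 \<Rightarrow> real \<Rightarrow> real^2 \<Rightarrow> real^2 \<Rightarrow> bool" where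
  "admissible K f F0 u0 \<longleftrightarrow>
     (\<exists>t. K *v u0 = F0 + t \<and> u0 $ 1 \<le> 0 \<and> t $ 1 \<le> 0 \<and> u0 $ 1 * t $ 1 = 0 \<and>
          \<bar>t $ 2\<bar> \<le> - f * t $ 1)"

text \<open>
  The friction law is the equality of two (signed) measures on \<open>[0, S]\<close>: the one with density the
  tangential reaction with respect to the Stieltjes measure of the tangential displacement, and
  the one with density \<open>f\<close> times the normal reaction with respect to its total variation.
\<close>

definition friction_law :: "real \<Rightarrow> real \<Rightarrow> (real \<Rightarrow> real^2) \<Rightarrow> (real \<Rightarrow> real^2) \<Rightarrow> bool" where
  "friction_law f S u t \<longleftrightarrow>
     (let M = restrict_space borel {0..S};
          \<mu> = stieltjes S (\<lambda>s. u s $ 2)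
      in \<forall>A\<in>sets M.
           signed_set_integral M \<mu> A (\<lambda>s. t s $ 2) =
           (LINT s:A|total_variation_measure M \<mu>. f * t s $ 1))"

definition quasi_static_solution ::
    "real^2^2 \<Rightarrow> real \<Rightarrow> real \<Rightarrow> (real \<Rightarrow> real^2) \<Rightarrow> real^2 \<Rightarrow>
     (real \<Rightarrow> real^2) \<Rightarrow> (real \<Rightarrow> real^2) \<Rightarrow> bool" where
  "quasi_static_solution K f S F u0 u t \<longleftrightarrow>
     F \<in> BV_plus S \<and> admissible K f (F 0) u0 \<and>
     u \<in> BV_plus S \<and> t \<in> BV_plus S \<and> u 0 = u0 \<and>
     (\<forall>s\<in>{0..S}.
        K *v u s = F s + t s \<and>
        u s $ 1 \<le> 0 \<and> t s $ 1 \<le> 0 \<and> u s $ 1 * t s $ 1 = 0 \<and>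
        \<bar>t s $ 2\<bar> \<le> - f * t s $ 1) \<and>
     friction_law f S u t"

definition solves_quasi_static ::
    "real^2^2 \<Rightarrow> real \<Rightarrow> real \<Rightarrow> (real \<Rightarrow> real^2) \<Rightarrow> real^2 \<Rightarrow> (real \<Rightarrow> real^2) \<Rightarrow> bool" where
  "solves_quasi_static K f S F u0 u \<longleftrightarrow> (\<exists>t. quasi_static_solution K f S F u0 u t)"

end

theory Submission
  imports Defs
begin

text \<open>
  On \<open>[0, 1[\<close> the point sticks with the reaction on the edge of the friction cone, and on \<open>[1, 2]\<close> it
  moves without contact, so that both sides of the friction law vanish.

  Conversely, let \<open>v\<close> be a solution that vanishes on \<open>[0, 1[\<close> and let \<open>s > 1\<close>.  If \<open>t(s) = 0\<close> then
  \<open>v(s)\<close> solves \<open>K v(s) = F(s)\<close>, hence \<open>v(s) = u(s)\<close>.  Otherwise \<open>v\<^sub>n(s) = 0\<close>, and the inequality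
  \<open>-t\<^sub>t \<le> -f t\<^sub>n\<close> reads \<open>(f k\<^sub>n\<^sub>t - k\<^sub>t\<^sub>t) v\<^sub>t(s) \<le> -(s - 1)\<close>; thus \<open>f k\<^sub>n\<^sub>t > k\<^sub>t\<^sub>t\<close> and
  \<open>v\<^sub>t(s) < 0\<close>.  At such states \<open>t\<^sub>t < -f t\<^sub>n\<close>, which by the friction law forces the negative part
  of the Stieltjes measure of \<open>v\<^sub>t\<close> to vanish there: \<open>v\<^sub>t\<close> never becomes negative.  The value at
  \<open>s = 1\<close> follows from right-continuity.
\<close>


section \<open>Jordan decomposition\<close>

lemma sets_variation [simp]:
  "sets (upper_variation M \<mu>) = sets M" "sets (lower_variation M \<mu>) = sets M"
  "sets (total_variation_measure M \<mu>) = sets M"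
  by (simp_all add: upper_variation_def lower_variation_def total_variation_measure_def)

text \<open>\<open>measure_of\<close> yields the zero measure unless its set function is positive
  and countably additive, which is not evident for a supremum. Since only values on
  \<open>sets M\<close> count, the supremum can be exchanged for a formula whose additivity is
  known.\<close>

lemma emeasure_measure_of_sets:
  assumes "A \<in> sets M" "positive (sets M) G" "countably_additive (sets M) G"
    and "\<And>A. A \<in> sets M \<Longrightarrow> F A = G A"
  shows "emeasure (measure_of (space M) (sets M) F) A = G A"
proof -
  have "measure_of (space M) (sets M) F = measure_of (space M) (sets M) G"
    using assms(4) by (intro measure_of_eq sets.space_closed) (simp add: sets.sigma_sets_eq)
  then show ?thesis
    using assms(1-3) by (simp add: emeasure_measure_of_sigma sets.sigma_algebra_axioms)
qed

text \<open>A Hahn set \<open>Y\<close> of the pair \<open>m1\<close>, \<open>m2\<close> makes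
  \<open>\<mu>\<close> nonnegative on measurable subsets of \<open>Y\<close> and nonpositive on
  measurable sets disjoint from it. The suprema defining the variations are then attained at
  \<open>A \<inter> Y\<close> and \<open>A - Y\<close>, which gives explicit formulas to compute
  with.\<close>

lemma jordan_decomposition:
  assumes fin: "finite_measure m1" "finite_measure m2"
    and sets_eq: "sets m1 = sets M" "sets m2 = sets M"
    and mu: "\<And>A. A \<in> sets M \<Longrightarrow> \<mu> A = measure m1 A - measure m2 A"
  obtains Y where "Y \<in> sets M"
    "\<And>A. A \<in> sets M \<Longrightarrow> 0 \<le> \<mu> (A \<inter> Y)"
    "\<And>A. A \<in> sets M \<Longrightarrow> \<mu> (A - Y) \<le> 0"
    "\<And>A. A \<in> sets M \<Longrightarrow> \<mu> A = \<mu> (A \<inter> Y) + \<mu> (A - Y)"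
    "\<And>A. A \<in> sets M \<Longrightarrow> emeasure (upper_variation M \<mu>) A = ennreal (\<mu> (A \<inter> Y))"
    "\<And>A. A \<in> sets M \<Longrightarrow> emeasure (lower_variation M \<mu>) A = ennreal (- \<mu> (A - Y))"
    "\<And>A. A \<in> sets M \<Longrightarrow> emeasure (total_variation_measure M \<mu>) A =
       ennreal (\<mu> (A \<inter> Y)) + ennreal (- \<mu> (A - Y))"
proof -
  interpret m1: finite_measure m1 by fact
  interpret m2: finite_measure m2 by fact
  obtain Y where Y: "Y \<in> sets M"
    and pos: "\<And>X. X \<in> sets M \<Longrightarrow> X \<subseteq> Y \<Longrightarrow> emeasure m2 X \<le> emeasure m1 X"
    and neg: "\<And>X. X \<in> sets M \<Longrightarrow> X \<inter> Y = {} \<Longrightarrow> emeasure m1 X \<le> emeasure m2 X"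
    using finite_unsigned_Hahn_decomposition[OF fin] sets_eq by auto
  have mu_pos: "0 \<le> \<mu> X" if "X \<in> sets M" "X \<subseteq> Y" for X
    using pos[OF that] mu[OF that(1)] by (simp add: m1.emeasure_eq_measure m2.emeasure_eq_measure)
  have mu_neg: "\<mu> X \<le> 0" if "X \<in> sets M" "X \<inter> Y = {}" for X
    using neg[OF that] mu[OF that(1)] by (simp add: m1.emeasure_eq_measure m2.emeasure_eq_measure)
  have mu_add: "\<mu> (A \<union> B) = \<mu> A + \<mu> B" if "A \<in> sets M" "B \<in> sets M" "A \<inter> B = {}" for A B
    using that m1.finite_measure_Union[of A B] m2.finite_measure_Union[of A B]
    by (simp add: mu sets_eq)
  have mu_split: "\<mu> A = \<mu> (A \<inter> B) + \<mu> (A - B)" if "A \<in> sets M" "B \<in> sets M" for A B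
    using mu_add[of "A \<inter> B" "A - B"] that by (simp add: Int_Diff_Un Int_Diff_disjoint)
  have mu_sums: "(\<lambda>i. \<mu> (A i)) sums \<mu> (\<Union>i. A i)"
    if "range A \<subseteq> sets M" "disjoint_family A" for A :: "nat \<Rightarrow> _"
  proof -
    have "A i \<in> sets M" for i using that by auto
    then show ?thesis
      using m1.finite_measure_UNION[of A] m2.finite_measure_UNION[of A] that
      by (simp add: mu sets_eq sums_diff sets.countable_UN)
  qed
  define p where "p A = \<mu> (A \<inter> Y)" for A
  define n where "n A = - \<mu> (A - Y)" for A
  have p_nonneg: "0 \<le> p A" if "A \<in> sets M" for A
    using that Y by (auto simp: p_def intro: mu_pos)
  have n_nonneg: "0 \<le> n A" if "A \<in> sets M" for A
    using that Y mu_neg[of "A - Y"] by (auto simp: n_def)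
  have ca: "countably_additive (sets M) (\<lambda>A. ennreal (p A))"
    "countably_additive (sets M) (\<lambda>A. ennreal (n A))"
  proof -
    show "countably_additive (sets M) (\<lambda>A. ennreal (p A))"
    proof (rule countably_additiveI)
      fix A :: "nat \<Rightarrow> _" assume A: "range A \<subseteq> sets M" "disjoint_family A"
      then have "range (\<lambda>i. A i \<inter> Y) \<subseteq> sets M" "disjoint_family (\<lambda>i. A i \<inter> Y)"
        using Y by (auto simp: disjoint_family_on_def)
      from mu_sums[OF this] have "(\<lambda>i. p (A i)) sums p (\<Union>i. A i)" by (simp add: p_def)
      moreover have "0 \<le> p (A i)" for i using A by (intro p_nonneg) auto
      ultimately show "(\<Sum>i. ennreal (p (A i))) = ennreal (p (\<Union>i. A i))"
        by (rule suminf_ennreal_eq[rotated])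
    qed
    show "countably_additive (sets M) (\<lambda>A. ennreal (n A))"
    proof (rule countably_additiveI)
      fix A :: "nat \<Rightarrow> _" assume A: "range A \<subseteq> sets M" "disjoint_family A"
      then have "range (\<lambda>i. A i - Y) \<subseteq> sets M" "disjoint_family (\<lambda>i. A i - Y)"
        using Y by (auto simp: disjoint_family_on_def)
      from sums_minus[OF mu_sums[OF this]] have "(\<lambda>i. n (A i)) sums n (\<Union>i. A i)"
        by (simp add: n_def)
      moreover have "0 \<le> n (A i)" for i using A by (intro n_nonneg) auto
      ultimately show "(\<Sum>i. ennreal (n (A i))) = ennreal (n (\<Union>i. A i))"
        by (rule suminf_ennreal_eq[rotated])
    qed
  qed
  have mu_empty: "\<mu> {} = 0" using mu[of "{}"] by simp
  have positive: "positive (sets M) (\<lambda>A. ennreal (p A))" "positive (sets M) (\<lambda>A. ennreal (n A))"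
    by (auto simp: positive_def p_def n_def mu_empty)
  \<comment> \<open>Deleting the part of \<open>B\<close> outside \<open>Y\<close> and then
    enlarging to \<open>A \<inter> Y\<close> never decreases \<open>\<mu>\<close>.\<close>
  have sup_p: "(SUP B\<in>{B \<in> sets M. B \<subseteq> A}. ennreal (\<mu> B)) = ennreal (p A)" if A: "A \<in> sets M" for A
  proof (rule antisym[OF SUP_least])
    fix B assume B: "B \<in> {B \<in> sets M. B \<subseteq> A}"
    have "\<mu> B \<le> \<mu> (B \<inter> Y)" using mu_split[of B Y] mu_neg[of "B - Y"] B Y by auto
    also have "\<dots> \<le> \<mu> (A \<inter> Y)"
    proof -
      have "0 \<le> \<mu> (A \<inter> Y - B)" using A B Y by (intro mu_pos) auto
      moreover have "A \<inter> Y \<inter> B = B \<inter> Y" using B by auto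
      ultimately show ?thesis using mu_split[of "A \<inter> Y" B] A B Y by auto
    qed
    finally show "ennreal (\<mu> B) \<le> ennreal (p A)" by (simp add: p_def ennreal_leI)
  next
    show "ennreal (p A) \<le> (SUP B\<in>{B \<in> sets M. B \<subseteq> A}. ennreal (\<mu> B))"
      unfolding p_def using A Y by (intro SUP_upper) auto
  qed
  have sup_n: "(SUP B\<in>{B \<in> sets M. B \<subseteq> A}. ennreal (- \<mu> B)) = ennreal (n A)" if A: "A \<in> sets M" for A
  proof (rule antisym[OF SUP_least])
    fix B assume B: "B \<in> {B \<in> sets M. B \<subseteq> A}"
    have "\<mu> (B - Y) \<le> \<mu> B" using mu_split[of B Y] mu_pos[of "B \<inter> Y"] B Y by auto
    moreover have "\<mu> (A - Y) \<le> \<mu> (B - Y)"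
    proof -
      have "\<mu> (A - Y - B) \<le> 0" using A B Y by (intro mu_neg) auto
      moreover have "(A - Y) \<inter> B = B - Y" using B by auto
      ultimately show ?thesis using mu_split[of "A - Y" B] A B Y by auto
    qed
    ultimately show "ennreal (- \<mu> B) \<le> ennreal (n A)" by (simp add: n_def ennreal_leI)
  next
    show "ennreal (n A) \<le> (SUP B\<in>{B \<in> sets M. B \<subseteq> A}. ennreal (- \<mu> B))"
      unfolding n_def using A Y by (intro SUP_upper2[of "A - Y"]) auto
  qed
  have eP: "emeasure (upper_variation M \<mu>) A = ennreal (p A)" if "A \<in> sets M" for A
    unfolding upper_variation_def
    using that positive(1) ca(1) sup_p by (rule emeasure_measure_of_sets)
  have eN: "emeasure (lower_variation M \<mu>) A = ennreal (n A)" if "A \<in> sets M" for A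
    unfolding lower_variation_def upper_variation_def
    using that positive(2) ca(2) sup_n by (rule emeasure_measure_of_sets)
  have eT: "emeasure (total_variation_measure M \<mu>) A = ennreal (p A) + ennreal (n A)"
    if "A \<in> sets M" for A
  proof -
    \<comment> \<open>A sum of two measures is countably additive by termwise addition of series, so
      \<open>measure_of\<close> returns that sum.\<close>
    have "(\<Sum>i. emeasure (upper_variation M \<mu>) (A i) + emeasure (lower_variation M \<mu>) (A i)) =
        emeasure (upper_variation M \<mu>) (\<Union>i. A i) + emeasure (lower_variation M \<mu>) (\<Union>i. A i)"
      if "range A \<subseteq> sets M" "disjoint_family A" for A :: "nat \<Rightarrow> _"
      using that by (subst suminf_add[symmetric])
        (auto simp: suminf_emeasure upper_variation_def lower_variation_def)
    then have "emeasure (total_variation_measure M \<mu>) A =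
        emeasure (upper_variation M \<mu>) A + emeasure (lower_variation M \<mu>) A"
      using that
      by (intro emeasure_measure_of[OF total_variation_measure_def sets.space_closed])
        (auto simp: positive_def countably_additive_def total_variation_measure_def)
    then show ?thesis using that by (simp add: eP eN)
  qed
  show ?thesis
  proof (rule that[OF Y])
    fix A assume A: "A \<in> sets M"
    show "0 \<le> \<mu> (A \<inter> Y)" using p_nonneg[OF A] by (simp add: p_def)
    show "\<mu> (A - Y) \<le> 0" using n_nonneg[OF A] by (simp add: n_def)
    show "\<mu> A = \<mu> (A \<inter> Y) + \<mu> (A - Y)" by (rule mu_split[OF A Y])
    show "emeasure (upper_variation M \<mu>) A = ennreal (\<mu> (A \<inter> Y))"
      using eP[OF A] by (simp only: p_def)
    show "emeasure (lower_variation M \<mu>) A = ennreal (- \<mu> (A - Y))"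
      using eN[OF A] by (simp only: n_def)
    show "emeasure (total_variation_measure M \<mu>) A =
        ennreal (\<mu> (A \<inter> Y)) + ennreal (- \<mu> (A - Y))"
      using eT[OF A] by (simp only: p_def n_def)
  qed
qed


section \<open>Functions of bounded variation\<close>

text \<open>Increments of \<open>g\<close> are bounded by those of its variation \<open>V\<close>,
  so \<open>V\<close> and \<open>V - g\<close> are nondecreasing. With right-continuity this gives
  \<open>interval_measure\<close> its meaning, and it exhibits \<open>g\<close> as a difference of
  monotone functions.\<close>

lemma variation_clamp_regular:
  assumes g: "g \<in> BV_plus S" and S: "0 \<le> S"
  shows "x \<le> y \<Longrightarrow> variation 0 (clamp_to S x) g \<le> variation 0 (clamp_to S y) g"
    and "x \<le> y \<Longrightarrow> variation 0 (clamp_to S x) g - g (clamp_to S x) \<le>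
           variation 0 (clamp_to S y) g - (g (clamp_to S y) :: real)"
    and "continuous (at_right a) (\<lambda>x. variation 0 (clamp_to S x) g)"
    and "continuous (at_right a) (\<lambda>x. variation 0 (clamp_to S x) g - g (clamp_to S x))"
proof -
  have bv: "bounded_variation 0 S g" and gc: "\<And>s. s \<in> {0..<S} \<Longrightarrow> continuous (at_right s) g"
    using g by (auto simp: BV_plus_def)
  have "norm (g (clamp_to S y) - g (clamp_to S x)) \<le>
      variation 0 (clamp_to S y) g - variation 0 (clamp_to S x) g" if "x \<le> y" for x y
    using variation_increment[OF bv] clamp_to_bounds[OF S] clamp_to_mono[OF that] by blast
  then show "x \<le> y \<Longrightarrow> variation 0 (clamp_to S x) g \<le> variation 0 (clamp_to S y) g"
    "x \<le> y \<Longrightarrow> variation 0 (clamp_to S x) g - g (clamp_to S x) \<le>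
           variation 0 (clamp_to S y) g - g (clamp_to S y)"
    by (smt (verit) real_norm_def)+
  show V: "continuous (at_right a) (\<lambda>x. variation 0 (clamp_to S x) g)"
    by (rule continuous_right_clamp[OF S continuous_right_variation[OF g]])
  show "continuous (at_right a) (\<lambda>x. variation 0 (clamp_to S x) g - g (clamp_to S x))"
    by (intro continuous_diff V continuous_right_clamp[OF S gc])
qed

lemma finite_measure_restrict_interval_measure:
  assumes "\<And>x y. x \<le> y \<Longrightarrow> G x \<le> G y" "\<And>a. continuous (at_right a) G"
  shows "finite_measure (restrict_space (interval_measure G) {a..b})"
proof (rule finite_measureI)
  have "emeasure (restrict_space (interval_measure G) {a..b}) {a..b} =
      emeasure (interval_measure G) {a..b}"
    by (rule emeasure_restrict_space) auto
  \<comment> \<open>The mass formula covers left-open intervals; moving the left end by 1 includes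
    the point \<open>a\<close>.\<close>
  also have "\<dots> \<le> emeasure (interval_measure G) {a - 1<..b}"
    by (intro emeasure_mono) auto
  also have "\<dots> < \<infinity>"
    by (simp add: emeasure_interval_measure_Ioc_eq[OF assms])
  finally show "emeasure (restrict_space (interval_measure G) {a..b})
      (space (restrict_space (interval_measure G) {a..b})) \<noteq> \<infinity>"
    by (simp add: space_restrict_space)
qed

text \<open>Supplies the hypotheses of \<open>jordan_decomposition\<close>: the two interval
  measures live on the whole line, and both become finite measures once cut down to
  \<open>{0..S}\<close>.\<close>

lemma stieltjes_eq_measure_diff:
  assumes g: "g \<in> BV_plus S" and S: "0 \<le> S"
  obtains m1 m2 where "finite_measure m1" "finite_measure m2"
    "sets m1 = sets (restrict_space borel {0..S})" "sets m2 = sets (restrict_space borel {0..S})"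
    "\<And>A. A \<in> sets (restrict_space borel {0..S}) \<Longrightarrow> stieltjes S g A = measure m1 A - measure m2 A"
proof
  note reg = variation_clamp_regular[OF g S]
  let ?V = "restrict_space (interval_measure (\<lambda>x. variation 0 (clamp_to S x) g)) {0..S}"
  let ?W = "restrict_space (interval_measure
    (\<lambda>x. variation 0 (clamp_to S x) g - g (clamp_to S x))) {0..S}"
  show "finite_measure ?V" "finite_measure ?W"
    by (intro finite_measure_restrict_interval_measure reg; assumption)+
  show "sets ?V = sets (restrict_space borel {0..S})" "sets ?W = sets (restrict_space borel {0..S})"
    by (simp_all add: sets_restrict_space)
  show "stieltjes S g A = measure ?V A - measure ?W A"
    if "A \<in> sets (restrict_space borel {0..S})" for A
    using that by (simp add: stieltjes_def measure_restrict_space sets_restrict_space_iff)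
qed

lemma stieltjes_Ioc:
  assumes g: "g \<in> BV_plus S" and s: "0 \<le> s1" "s1 \<le> s2" "s2 \<le> S"
  shows "stieltjes S g {s1<..s2} = g s2 - g s1"
proof -
  have S: "0 \<le> S" using s by simp
  note reg = variation_clamp_regular[OF g S]
  have "clamp_to S s1 = s1" "clamp_to S s2 = s2" using s by (auto simp: clamp_to_def)
  then show ?thesis
    unfolding stieltjes_def
    by (simp add: measure_interval_measure_Ioc[OF s(2) reg(1,3)] measure_interval_measure_Ioc[OF s(2) reg(2,4)])
qed

text \<open>Both \<open>V\<close> and \<open>V - g\<close> are monotone, hence have left limits,
  namely their suprema over \<open>{..<a}\<close>; \<open>g\<close> is their difference.\<close>

lemma BV_plus_left_limit:
  fixes g :: "real \<Rightarrow> real"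
  assumes g: "g \<in> BV_plus S" and S: "0 \<le> S"
  obtains l where "((\<lambda>x. g (clamp_to S x)) \<longlongrightarrow> l) (at_left a)"
proof -
  note reg = variation_clamp_regular[OF g S]
  have lim: "(G \<longlongrightarrow> Sup (G ` {..<a})) (at_left a)" if "\<And>x y. x \<le> y \<Longrightarrow> G x \<le> G y" for G :: "real \<Rightarrow> real"
    using Lim_left_bound[of UNIV a G "G a"] that by simp
  let ?V = "\<lambda>x. variation 0 (clamp_to S x) g"
  let ?W = "\<lambda>x. variation 0 (clamp_to S x) g - g (clamp_to S x)"
  have "((\<lambda>x. ?V x - ?W x) \<longlongrightarrow> Sup (?V ` {..<a}) - Sup (?W ` {..<a})) (at_left a)"
    by (intro tendsto_diff lim reg; assumption)
  then show ?thesis by (intro that) simp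
qed

lemma BV_plus_bounded:
  assumes "g \<in> BV_plus S" "s \<in> {0..S}"
  shows "norm (g s) \<le> norm (g 0) + variation 0 S g"
proof -
  have bv: "bounded_variation 0 S g" using assms by (simp add: BV_plus_def)
  have "variation_sum g [0, s] \<le> variation 0 S g"
    using assms by (intro variation_upper[OF bv]) (auto simp: partitions_def)
  then show ?thesis using norm_triangle_sub[of "g s" "g 0"] by simp
qed

lemma BV_plus_measurable:
  fixes g :: "real \<Rightarrow> real"
  assumes g: "g \<in> BV_plus S" and S: "0 \<le> S"
  shows "g \<in> borel_measurable (restrict_space borel {0..S})"
proof -
  note reg = variation_clamp_regular[OF g S]
  have "(\<lambda>x. variation 0 (clamp_to S x) g - (variation 0 (clamp_to S x) g - g (clamp_to S x)))
      \<in> borel_measurable borel"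
    by (intro borel_measurable_diff borel_measurable_mono monoI reg; assumption)
  then have "(\<lambda>x. g (clamp_to S x)) \<in> borel_measurable (restrict_space borel {0..S})"
    by (intro measurable_restrict_space1) simp
  then show ?thesis
    by (rule measurable_cong[THEN iffD1, rotated]) (auto simp: space_restrict_space clamp_to_def)
qed

lemma BV_plus_nth:
  fixes g :: "real \<Rightarrow> real^'n"
  assumes "g \<in> BV_plus S"
  shows "(\<lambda>s. g s $ i) \<in> BV_plus S"
proof -
  have bv: "bounded_variation 0 S g" and gc: "\<And>s. s \<in> {0..<S} \<Longrightarrow> continuous (at_right s) g"
    using assms by (auto simp: BV_plus_def)
  have "variation_sum (\<lambda>s. g s $ i) xs \<le> variation_sum g xs" for xs
    unfolding variation_sum_def
    by (intro sum_mono) (simp flip: vector_minus_component add: component_le_norm_cart)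
  then have "bounded_variation 0 S (\<lambda>s. g s $ i)"
    unfolding bounded_variation_def
    by (intro bdd_aboveI2[of _ _ "variation 0 S g"]) (meson bv order_trans variation_upper)
  moreover have "continuous (at_right s) (\<lambda>s. g s $ i)" if "s \<in> {0..<S}" for s
    using gc[OF that] by (auto intro: continuous_intros)
  ultimately show ?thesis by (simp add: BV_plus_def)
qed

text \<open>The increments of \<open>g\<close> are dominated by those of a nondecreasing
  \<open>G\<close> with slope \<open>L\<close> and one jump at \<open>c\<close>; such a bound
  telescopes along every partition.\<close>

lemma BV_plus_piecewise_lipschitz:
  fixes g :: "real \<Rightarrow> 'a::real_normed_vector"
  assumes c: "0 \<le> c" "c \<le> S"
    and lip: "L-lipschitz_on {0..<c} g" "L-lipschitz_on {c..S} g"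
  shows "g \<in> BV_plus S"
proof -
  have L: "0 \<le> L" using lip(1) by (rule lipschitz_on_nonneg)
  \<comment> \<open>Across \<open>c\<close> the path from \<open>x\<close> to \<open>y\<close> is
    routed through \<open>0\<close> and \<open>c\<close>, which avoids the left limit at
    \<open>c\<close>. The extra \<open>L * c\<close> pays for the way back from \<open>x\<close> to
    \<open>0\<close>.\<close>
  define J where "J = norm (g c - g 0) + L * c"
  have J: "0 \<le> J" using L c by (simp add: J_def)
  define G where "G x = L * x + (if c \<le> x then J else 0)" for x
  have inc: "norm (g y - g x) \<le> G y - G x" if "0 \<le> x" "x \<le> y" "y \<le> S" for x y
  proof -
    consider "y < c" | "c \<le> x" | "x < c" "c \<le> y" by linarith
    then show ?thesis
    proof cases
      case 1
      then show ?thesis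
        using lipschitz_onD[OF lip(1), of y x] that by (auto simp: G_def dist_norm algebra_simps)
    next
      case 2
      then show ?thesis
        using lipschitz_onD[OF lip(2), of y x] that by (auto simp: G_def dist_norm algebra_simps)
    next
      case 3
      have "norm (g y - g c) \<le> L * (y - c)" "norm (g x - g 0) \<le> L * x"
        using lipschitz_onD[OF lip(2), of y c] lipschitz_onD[OF lip(1), of x 0] that 3
        by (auto simp: dist_norm)
      moreover have "norm (g y - g x) \<le> norm (g y - g c) + norm (g c - g 0) + norm (g x - g 0)"
        using norm_triangle_ineq4[of "g y - g c + (g c - g 0)" "g x - g 0"]
          norm_triangle_ineq[of "g y - g c" "g c - g 0"] by (simp add: algebra_simps)
      moreover have "G y - G x = L * (y - c) + norm (g c - g 0) + L * c + L * (c - x)"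
        using 3 by (simp add: G_def J_def algebra_simps)
      moreover have "0 \<le> L * (c - x)" "L * x \<le> L * c" using L 3 that by (auto intro: mult_left_mono)
      ultimately show ?thesis by linarith
    qed
  qed
  have "variation_sum g xs \<le> G S - G 0" if "sorted xs" "set xs \<subseteq> {0..S}" for xs
  proof -
    \<comment> \<open>Keeping \<open>G (hd ys)\<close> instead of \<open>G 0\<close> makes the
      induction telescope.\<close>
    have tail: "variation_sum g ys \<le> G S - G (hd ys)"
      if "ys \<noteq> []" "sorted ys" "set ys \<subseteq> {0..S}" for ys
      using that
    proof (induction ys rule: induct_list012)
      case (2 x)
      then show ?case using inc[of x S] norm_ge_zero[of "g S - g x"] by (simp del: norm_ge_zero)
    next
      case (3 x y zs)
      then show ?case using inc[of x y] by simp
    qed simp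
    show ?thesis
    proof (cases xs)
      case Nil
      then show ?thesis using inc[of 0 S] c norm_ge_zero[of "g S - g 0"] by (simp del: norm_ge_zero)
    next
      case (Cons x ys)
      then show ?thesis
        using that tail[of xs] inc[of 0 x] norm_ge_zero[of "g x - g 0"] by (simp del: norm_ge_zero)
    qed
  qed
  then have "bounded_variation 0 S g"
    unfolding bounded_variation_def by (intro bdd_aboveI2) (auto simp: partitions_def)
  moreover have "continuous (at_right s) g" if s: "s \<in> {0..<S}" for s
  proof -
    have at: "continuous (at_right s) g" if "continuous_on {a..<b} g" "a \<le> s" "s < b" for a b
    proof -
      have "s \<in> {a..<b}" using that by simp
      then have "(g \<longlongrightarrow> g s) (at s within {a..<b})"
        using that(1) by (auto simp: continuous_on_def)
      then have "(g \<longlongrightarrow> g s) (at s within {s..(s + b) / 2})"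
        by (rule tendsto_within_subset) (use that in auto)
      then show ?thesis using that by (simp add: continuous_within at_within_Icc_at_right)
    qed
    have "continuous_on {0..<c} g" "continuous_on {c..<S} g"
      using lip by (auto intro: lipschitz_on_continuous_on continuous_on_subset)
    then show ?thesis using at[of 0 c] at[of c S] s by (cases "s < c") auto
  qed
  ultimately show ?thesis by (simp add: BV_plus_def)
qed


section \<open>The friction law\<close>

text \<open>Let \<open>B\<close> be the part of \<open>A\<close> outside the positive Hahn set.
  There the upper variation is null and the total variation equals the lower one, so the law says
  that \<open>t s $ 2 + f * t s $ 1\<close> has integral 0 over \<open>B\<close> for the lower
  variation. The integrand being negative, \<open>B\<close> is null, and only the nonnegative part
  of \<open>A\<close> remains.\<close>

lemma stieltjes_nonneg_of_friction_law:
  assumes u: "u \<in> BV_plus S" and t: "t \<in> BV_plus S" and S: "0 \<le> S"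
    and law: "friction_law f S u t"
    and A: "A \<in> sets (restrict_space borel {0..S})"
    and slip: "\<And>s. s \<in> A \<Longrightarrow> t s $ 2 + f * t s $ 1 < 0"
  shows "0 \<le> stieltjes S (\<lambda>s. u s $ 2) A"
proof -
  define M where "M = restrict_space (borel :: real measure) {0..S}"
  define \<mu> where "\<mu> = stieltjes S (\<lambda>s. u s $ 2)"
  note t1 = BV_plus_nth[OF t, of 1] and t2 = BV_plus_nth[OF t, of 2]
  obtain m1 m2 where m: "finite_measure m1" "finite_measure m2" "sets m1 = sets M" "sets m2 = sets M"
    "\<And>A. A \<in> sets M \<Longrightarrow> \<mu> A = measure m1 A - measure m2 A"
    using stieltjes_eq_measure_diff[OF BV_plus_nth[OF u, of 2] S] unfolding M_def \<mu>_def by metis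
  obtain Y where Y: "Y \<in> sets M"
    and pos: "\<And>A. A \<in> sets M \<Longrightarrow> 0 \<le> \<mu> (A \<inter> Y)"
    and split: "\<And>A. A \<in> sets M \<Longrightarrow> \<mu> A = \<mu> (A \<inter> Y) + \<mu> (A - Y)"
    and P: "\<And>A. A \<in> sets M \<Longrightarrow> emeasure (upper_variation M \<mu>) A = ennreal (\<mu> (A \<inter> Y))"
    and N: "\<And>A. A \<in> sets M \<Longrightarrow> emeasure (lower_variation M \<mu>) A = ennreal (- \<mu> (A - Y))"
    and T: "\<And>A. A \<in> sets M \<Longrightarrow> emeasure (total_variation_measure M \<mu>) A =
       ennreal (\<mu> (A \<inter> Y)) + ennreal (- \<mu> (A - Y))"
    using jordan_decomposition[OF m] by metis
  define B where "B = A - Y"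
  have AM: "A \<in> sets M" using A by (simp add: M_def)
  have B: "B \<in> sets M" "B \<inter> Y = {}" using AM Y by (auto simp: B_def)
  have mu_empty: "\<mu> {} = 0" using m(5)[of "{}"] by simp
  define R where "R = restrict_space (lower_variation M \<mu>) B"
  have R_eq: "restrict_space (total_variation_measure M \<mu>) B = R"
  proof (rule measure_eqI)
    show "sets (restrict_space (total_variation_measure M \<mu>) B) = sets R"
      by (simp add: R_def sets_restrict_space)
    fix C assume "C \<in> sets (restrict_space (total_variation_measure M \<mu>) B)"
    then have "C \<in> sets M" "C \<subseteq> B" "C \<inter> Y = {}"
      using B by (auto simp: sets_restrict_space_iff)
    then show "emeasure (restrict_space (total_variation_measure M \<mu>) B) C = emeasure R C"
      using B by (simp add: R_def emeasure_restrict_space N T mu_empty)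
  qed
  have R_int: "(LINT s:B|total_variation_measure M \<mu>. h s) = integral\<^sup>L R h"
    "(LINT s:B|lower_variation M \<mu>. h s) = integral\<^sup>L R h" for h :: "real \<Rightarrow> real"
  proof -
    show "(LINT s:B|lower_variation M \<mu>. h s) = integral\<^sup>L R h"
      using B(1) by (simp add: set_lebesgue_integral_def R_def integral_restrict_space)
    show "(LINT s:B|total_variation_measure M \<mu>. h s) = integral\<^sup>L R h"
      unfolding R_eq[symmetric] using B(1)
      by (simp add: set_lebesgue_integral_def integral_restrict_space)
  qed
  have P_null: "(LINT s:B|upper_variation M \<mu>. h s) = 0" for h :: "real \<Rightarrow> real"
  proof -
    have "B \<in> null_sets (upper_variation M \<mu>)"
      using B by (intro null_setsI) (simp_all add: P mu_empty)
    then have "AE s in upper_variation M \<mu>. s \<notin> B" by (rule AE_not_in)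
    then show ?thesis
      unfolding set_lebesgue_integral_def
      by (intro integral_eq_zero_AE) (auto elim!: eventually_mono)
  qed
  have R_B: "emeasure R B = ennreal (- \<mu> B)"
    using B by (simp add: R_def emeasure_restrict_space N) (simp add: B_def)
  have space_R: "space R = B"
    using B sets.sets_into_space[OF B(1)] sets_eq_imp_space_eq[of "lower_variation M \<mu>" M]
    by (auto simp: R_def space_restrict_space)
  interpret R: finite_measure R
    by (rule finite_measureI) (simp add: space_R R_B)
  \<comment> \<open>Integrals of non-integrable functions default to 0, so integrability is required
    before the two sides of the law are merged into one vanishing integral.\<close>
  have int: "integrable R g" if g: "g \<in> BV_plus S" for g :: "real \<Rightarrow> real"
  proof (rule R.integrable_const_bound)
    have "B \<subseteq> {0..S}" using sets.sets_into_space[OF B(1)] by (simp add: M_def space_restrict_space)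
    then show "AE s in R. norm (g s) \<le> norm (g 0) + variation 0 S g"
      using BV_plus_bounded[OF g] by (intro AE_I2) (auto simp: space_R)
    have "g \<in> borel_measurable (lower_variation M \<mu>)"
      using BV_plus_measurable[OF g S] measurable_cong_sets[OF sets_variation(2) refl]
      by (auto simp: M_def)
    then show "g \<in> borel_measurable R"
      unfolding R_def by (rule measurable_restrict_space1)
  qed
  have "- integral\<^sup>L R (\<lambda>s. t s $ 2) = integral\<^sup>L R (\<lambda>s. f * t s $ 1)"
  proof -
    have "signed_set_integral M \<mu> B (\<lambda>s. t s $ 2) =
        (LINT s:B|total_variation_measure M \<mu>. f * t s $ 1)"
      using law B(1) unfolding friction_law_def Let_def M_def \<mu>_def by blast
    then show ?thesis unfolding signed_set_integral_def P_null R_int by linarith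
  qed
  then have "integral\<^sup>L R (\<lambda>s. - (t s $ 2 + f * t s $ 1)) = 0"
    using int[OF t1] int[OF t2] by simp
  moreover have "integrable R (\<lambda>s. - (t s $ 2 + f * t s $ 1))"
    using int[OF t1] int[OF t2] by simp
  moreover have "AE s in R. 0 \<le> - (t s $ 2 + f * t s $ 1)"
    using slip by (intro AE_I2) (force simp: space_R B_def)
  ultimately have "AE s in R. - (t s $ 2 + f * t s $ 1) = 0"
    using integral_nonneg_eq_0_iff_AE by blast
  moreover have "AE s in R. t s $ 2 + f * t s $ 1 < 0"
    using slip by (intro AE_I2) (auto simp: space_R B_def)
  ultimately have "AE s in R. s \<notin> B" by eventually_elim simp
  moreover have "B \<in> sets R" using sets.top[of R] by (simp add: space_R)
  ultimately have "emeasure R B = 0" using AE_iff_null_sets[of B R] by auto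
  then have "0 \<le> \<mu> B" using R_B by (simp add: ennreal_eq_0_iff)
  then have "0 \<le> \<mu> A" using split[OF AM] pos[OF AM] by (simp add: B_def)
  then show ?thesis by (simp add: \<mu>_def)
qed

text \<open>A jump of \<open>g\<close> at \<open>c\<close> is allowed, since \<open>A\<close>
  excludes \<open>c\<close>. Therefore \<open>{0..<c}\<close> is exhausted by intervals ending
  strictly before \<open>c\<close>, each of mass 0.\<close>

lemma stieltjes_eq_0:
  assumes g: "g \<in> BV_plus S" and c: "c \<le> S" and S: "0 \<le> S"
    and const: "\<And>s. s \<in> {0..<c} \<Longrightarrow> g s = g 0"
    and A: "A \<subseteq> {0..<c}" "A \<in> sets borel"
  shows "stieltjes S g A = 0"
proof (cases "0 < c")
  case True
  note reg = variation_clamp_regular[OF g S]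
  have null: "measure (interval_measure G) A = 0"
    if G: "\<And>x y. x \<le> y \<Longrightarrow> G x \<le> G y" "\<And>a. continuous (at_right a) G"
      and eq: "\<And>x. x < c \<Longrightarrow> G x = G 0" for G :: "real \<Rightarrow> real"
  proof -
    \<comment> \<open>The left end -1 of the intervals catches a possible atom at 0; there is none,
      because the clamped functions are constant to the left of 0.\<close>
    define b where "b n = c - 1 / real (Suc n)" for n
    have "emeasure (interval_measure G) {-1<..b n} = 0" for n
      using eq[of "-1"] eq[of "b n"] True emeasure_interval_measure_Ioc_eq[OF G, of "-1" "b n"]
      by (auto simp: b_def)
    then have "(\<Union>n. {-1<..b n}) \<in> null_sets (interval_measure G)"
      by (intro null_sets_UN) (simp add: null_setsI)
    moreover have "A \<subseteq> (\<Union>n. {-1<..b n})"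
    proof
      fix x assume "x \<in> A"
      then have x: "0 \<le> x" "x < c" using A by auto
      then obtain n where "inverse (real (Suc n)) < c - x"
        using reals_Archimedean[of "c - x"] by auto
      then have "x \<le> b n" by (simp add: b_def inverse_eq_divide)
      then show "x \<in> (\<Union>n. {-1<..b n})" using x by auto
    qed
    ultimately have "A \<in> null_sets (interval_measure G)"
      using A(2) by (auto intro: null_sets_subset)
    then show ?thesis by (simp add: measure_eq_0_null_sets)
  qed
  have var: "variation 0 x g = 0" if "x < c" for x
  proof -
    have "variation_sum g xs = 0" if "xs \<in> partitions 0 x" for xs
    proof -
      have *: "g (xs ! i) = g 0" if "i < length xs" for i
      proof -
        have "xs ! i \<in> {0..x}"
          using nth_mem[OF that] \<open>xs \<in> partitions 0 x\<close> by (auto simp: partitions_def)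
        then show ?thesis using \<open>x < c\<close> by (intro const) simp
      qed
      show ?thesis
        unfolding variation_sum_def by (intro sum.neutral ballI) (simp add: *)
    qed
    then have "variation_sum g ` partitions 0 x = {0}"
      using partitions_Nil[of 0 x] by (auto intro!: image_eqI[of _ _ "[]"])
    then show ?thesis by (simp add: variation_def)
  qed
  have "clamp_to S x < c" "g (clamp_to S x) = g 0" if "x < c" for x
    using that True c by (auto simp: clamp_to_def intro!: const)
  moreover have "clamp_to S 0 = 0" using S by (simp add: clamp_to_def)
  ultimately have
    "measure (interval_measure (\<lambda>x. variation 0 (clamp_to S x) g)) A = 0"
    "measure (interval_measure (\<lambda>x. variation 0 (clamp_to S x) g - g (clamp_to S x))) A = 0"
    using True by - (rule null; (rule reg; assumption)?; simp add: var)+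
  then show ?thesis by (simp add: stieltjes_def)
next
  case False
  then have "A = {}" using A by auto
  then show ?thesis by (simp add: stieltjes_def)
qed

text \<open>On \<open>{0..<c}\<close> the measure vanishes, on \<open>{c..S}\<close> the densities
  do. The jump of \<open>u\<close> at \<open>c\<close> costs nothing because the density there is
  the value \<open>t c = 0\<close>, not the left limit of the reaction.\<close>

lemma friction_law_stick_then_free:
  assumes u: "u \<in> BV_plus S" and c: "c \<le> S" and S: "0 \<le> S"
    and stick: "\<And>s. s \<in> {0..<c} \<Longrightarrow> u s $ 2 = u 0 $ 2"
    and free: "\<And>s. s \<in> {c..S} \<Longrightarrow> t s = 0"
  shows "friction_law f S u t"
proof -
  define M where "M = restrict_space (borel :: real measure) {0..S}"
  define \<mu> where "\<mu> = stieltjes S (\<lambda>s. u s $ 2)"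
  obtain m1 m2 where m: "finite_measure m1" "finite_measure m2" "sets m1 = sets M" "sets m2 = sets M"
    "\<And>A. A \<in> sets M \<Longrightarrow> \<mu> A = measure m1 A - measure m2 A"
    using stieltjes_eq_measure_diff[OF BV_plus_nth[OF u, of 2] S] unfolding M_def \<mu>_def by metis
  obtain Y where Y: "Y \<in> sets M"
    and P: "\<And>A. A \<in> sets M \<Longrightarrow> emeasure (upper_variation M \<mu>) A = ennreal (\<mu> (A \<inter> Y))"
    and N: "\<And>A. A \<in> sets M \<Longrightarrow> emeasure (lower_variation M \<mu>) A = ennreal (- \<mu> (A - Y))"
    and T: "\<And>A. A \<in> sets M \<Longrightarrow> emeasure (total_variation_measure M \<mu>) A =
       ennreal (\<mu> (A \<inter> Y)) + ennreal (- \<mu> (A - Y))"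
    using jordan_decomposition[OF m] by metis
  define C where "C = {0..S} \<inter> {..<c}"
  have C: "C \<in> sets M" by (auto simp: M_def C_def sets_restrict_space)
  have mu0: "\<mu> A = 0" if "A \<subseteq> C" "A \<in> sets M" for A
    unfolding \<mu>_def
    using that by (intro stieltjes_eq_0[OF BV_plus_nth[OF u] c S stick])
      (fastforce simp: C_def M_def sets_restrict_space_iff)+
  have null: "(LINT s:A|Q. h s) = 0"
    if Q: "sets Q = sets M" "emeasure Q C = 0" and h: "\<And>s. s \<in> {c..S} \<Longrightarrow> h s = 0"
    for Q A and h :: "real \<Rightarrow> real"
  proof -
    have "C \<in> null_sets Q" using Q C by (intro null_setsI) auto
    then have "AE s in Q. s \<notin> C" by (rule AE_not_in)
    moreover have "AE s in Q. s \<in> {0..S}"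
      using sets_eq_imp_space_eq[OF Q(1)] by (intro AE_I2) (simp add: M_def space_restrict_space)
    ultimately have "AE s in Q. indicator A s *\<^sub>R h s = 0"
      by eventually_elim (use h in \<open>auto simp: C_def\<close>)
    then show ?thesis unfolding set_lebesgue_integral_def by (rule integral_eq_zero_AE)
  qed
  have "\<mu> (C \<inter> Y) = 0" "\<mu> (C - Y) = 0" using C Y by (auto intro!: mu0)
  then have "emeasure (upper_variation M \<mu>) C = 0" "emeasure (lower_variation M \<mu>) C = 0"
    "emeasure (total_variation_measure M \<mu>) C = 0"
    using P[OF C] N[OF C] T[OF C] by simp_all
  note zero = this
  show ?thesis
    unfolding friction_law_def Let_def signed_set_integral_def M_def[symmetric] \<mu>_def[symmetric]
  proof
    fix A
    have "(LINT s:A|upper_variation M \<mu>. t s $ 2) = 0" "(LINT s:A|lower_variation M \<mu>. t s $ 2) = 0"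
      "(LINT s:A|total_variation_measure M \<mu>. f * t s $ 1) = 0"
      by (rule null[OF sets_variation(1) zero(1)] null[OF sets_variation(2) zero(2)]
        null[OF sets_variation(3) zero(3)], simp add: free)+
    then show "(LINT s:A|upper_variation M \<mu>. t s $ 2) - (LINT s:A|lower_variation M \<mu>. t s $ 2) =
        (LINT s:A|total_variation_measure M \<mu>. f * t s $ 1)" by simp
  qed
qed


section \<open>The contact problem\<close>

text \<open>The slack \<open>norm q \<le> L\<close> lets affine pieces of different slopes share one
  constant.\<close>

lemma lipschitz_on_affine:
  fixes g :: "real \<Rightarrow> 'a::real_normed_vector"
  assumes "\<And>s. s \<in> X \<Longrightarrow> g s = p + s *\<^sub>R q" "norm q \<le> L"
  shows "L-lipschitz_on X g"
proof (rule lipschitz_onI)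
  show "0 \<le> L" using assms(2) norm_ge_zero order_trans by blast
  fix x y assume "x \<in> X" "y \<in> X"
  then have "dist (g x) (g y) = \<bar>x - y\<bar> * norm q"
    by (simp add: assms(1) dist_norm flip: scaleR_diff_left)
  also have "\<dots> \<le> \<bar>x - y\<bar> * L" using assms(2) by (rule mult_left_mono) simp
  finally show "dist (g x) (g y) \<le> L * dist x y" by (simp add: dist_real_def mult.commute)
qed

lemma matrix_vector_mult_2:
  fixes K :: "real^2^2"
  shows "(K *v x) $ i = K $ i $ 1 * x $ 1 + K $ i $ 2 * x $ 2"
  by (simp add: matrix_vector_mult_def sum_2)

lemma stiffness_matrix_entries:
  assumes "stiffness_matrix K"
  shows "K $ 2 $ 1 = K $ 1 $ 2" "0 < K $ 2 $ 2" "0 < K $ 1 $ 1 * K $ 2 $ 2 - (K $ 1 $ 2)\<^sup>2"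
proof -
  have "transpose K $ 1 $ 2 = K $ 1 $ 2" using assms by (simp add: stiffness_matrix_def)
  then show sym: "K $ 2 $ 1 = K $ 1 $ 2" by (simp add: transpose_def)
  have pos: "0 < x * (K $ 1 $ 1 * x + K $ 1 $ 2 * y) + y * (K $ 1 $ 2 * x + K $ 2 $ 2 * y)"
    if "x \<noteq> 0 \<or> y \<noteq> 0" for x y
  proof -
    define w where "w = (vector [x, y] :: real^2)"
    have "w \<noteq> 0" using that by (auto simp: w_def vec_eq_iff forall_2)
    then have "0 < w \<bullet> (K *v w)" using assms by (simp add: stiffness_matrix_def)
    then show ?thesis by (simp add: inner_vec_def sum_2 matrix_vector_mult_2 sym w_def)
  qed
  show c: "0 < K $ 2 $ 2" using pos[of 0 1] by simp
  \<comment> \<open>The test vector is chosen so that the second component of its image under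
    \<open>K\<close> vanishes; the quadratic form is then \<open>K $ 2 $ 2\<close> times the
    determinant.\<close>
  have "0 < K $ 2 $ 2 * (K $ 1 $ 1 * K $ 2 $ 2 - (K $ 1 $ 2)\<^sup>2)"
    using pos[of "K $ 2 $ 2" "- K $ 1 $ 2"] c by (simp add: algebra_simps power2_eq_square)
  then show "0 < K $ 1 $ 1 * K $ 2 $ 2 - (K $ 1 $ 2)\<^sup>2" using c by (simp add: zero_less_mult_iff)
qed

lemma symmetric_2x2_solve:
  fixes K :: "real^2^2"
  assumes "K $ 2 $ 1 = K $ 1 $ 2" "K $ 1 $ 1 * K $ 2 $ 2 - (K $ 1 $ 2)\<^sup>2 \<noteq> 0"
  shows "K *v w = F \<longleftrightarrow> w = vector
    [(K $ 2 $ 2 * F $ 1 - K $ 1 $ 2 * F $ 2) / (K $ 1 $ 1 * K $ 2 $ 2 - (K $ 1 $ 2)\<^sup>2),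
     (K $ 1 $ 1 * F $ 2 - K $ 1 $ 2 * F $ 1) / (K $ 1 $ 1 * K $ 2 $ 2 - (K $ 1 $ 2)\<^sup>2)]"
proof -
  have cramer: "a * x + b * y = p \<and> b * x + c * y = q \<longleftrightarrow>
      x = (c * p - b * q) / d \<and> y = (a * q - b * p) / d"
    if d: "d \<noteq> 0" "d = a * c - b\<^sup>2" for a b c d p q x y :: real
  proof
    assume "a * x + b * y = p \<and> b * x + c * y = q"
    then have "p = a * x + b * y" "q = b * x + c * y" by auto
    then have "d * x = c * p - b * q" "d * y = a * q - b * p"
      by (simp_all add: d(2) algebra_simps power2_eq_square)
    then show "x = (c * p - b * q) / d \<and> y = (a * q - b * p) / d"
      using d(1) by (simp add: eq_divide_eq mult.commute)
  next
    assume xy: "x = (c * p - b * q) / d \<and> y = (a * q - b * p) / d"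
    have "a * x + b * y = (a * (c * p - b * q) + b * (a * q - b * p)) / d"
      "b * x + c * y = (b * (c * p - b * q) + c * (a * q - b * p)) / d"
      using xy by (simp_all add: add_divide_distrib)
    moreover have "a * (c * p - b * q) + b * (a * q - b * p) = p * d"
      "b * (c * p - b * q) + c * (a * q - b * p) = q * d"
      by (simp_all add: d(2) algebra_simps power2_eq_square)
    ultimately show "a * x + b * y = p \<and> b * x + c * y = q" using d(1) by simp
  qed
  show ?thesis
    using cramer[OF assms(2) refl, of "w $ 1" "w $ 2" "F $ 1" "F $ 2"]
    by (simp add: vec_eq_iff forall_2 matrix_vector_mult_2 assms(1))
qed

text \<open>Pointwise algebra of the contact conditions, with \<open>\<sigma>\<close> the time
  elapsed since 1. In contact \<open>vn = 0\<close>, and \<open>f\<close> times the first equation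
  minus the second bounds \<open>vt\<close>, because \<open>f * tn - tt \<le> 0\<close>.\<close>

lemma free_or_backward_contact:
  fixes vn vt tn tt :: real
  assumes f: "0 < f" "c \<le> f * b" "0 < c" and R: "0 < R" and \<sigma>: "0 \<le> \<sigma>" "0 < \<sigma> \<or> c < f * b"
    and eq: "a * vn + b * vt = R / f + \<sigma> + tn" "b * vn + c * vt = R + (f + 1) * \<sigma> + tt"
    and contact: "vn * tn = 0" "\<bar>tt\<bar> \<le> - f * tn"
  shows "(tn = 0 \<and> tt = 0) \<or> (c < f * b \<and> (f * b - c) * vt \<le> - \<sigma> \<and> tt + f * tn < 0)"
proof (cases "tn = 0")
  case True
  then show ?thesis using contact by simp
next
  case False
  then have vn: "vn = 0" using contact by simp
  have "f * (b * vt) = f * (R / f + \<sigma> + tn)" using eq(1) vn by simp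
  then have 1: "f * b * vt = R + f * \<sigma> + f * tn" using f by (simp add: algebra_simps)
  have 2: "c * vt = R + (f + 1) * \<sigma> + tt" using eq(2) vn by simp
  have le: "(f * b - c) * vt \<le> - \<sigma>"
    using 1 2 contact(2) by (simp add: algebra_simps)
  \<comment> \<open>If \<open>c = f * b\<close>, the bound reads \<open>0 \<le> - \<sigma>\<close>,
    which contradicts \<open>0 < \<sigma>\<close>; so the degenerate case is excluded only strictly
    after time 1.\<close>
  have "c < f * b" using le \<sigma> f(2) by (cases "c = f * b") auto
  then have vt: "vt \<le> 0" using le \<sigma>(1) by (smt (verit) mult_pos_pos)
  have "tt + f * tn < 0"
  proof (rule ccontr)
    assume "\<not> tt + f * tn < 0"
    \<comment> \<open>The sum of the two equations: on the backward edge
      \<open>tt = - f * tn\<close>, the positive load \<open>R\<close> would force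
      \<open>vt > 0\<close>.\<close>
    moreover have "(f * b + c) * vt = 2 * R + \<sigma> + 2 * (f * \<sigma>) + (tt + f * tn)"
      using 1 2 by (simp add: algebra_simps)
    moreover have "0 \<le> f * \<sigma>" using f(1) \<sigma>(1) by simp
    ultimately have "0 < (f * b + c) * vt" using R \<sigma>(1) by linarith
    moreover have "0 < f * b + c" using f by linarith
    ultimately show False using vt by (simp add: zero_less_mult_iff)
  qed
  then show ?thesis using le \<open>c < f * b\<close> by simp
qed

text \<open>
  Where the reaction is off the backward edge of the friction cone, \<open>u\<close> cannot move backward, so
  it cannot jump or drift into the region where its tangential component is negative.
\<close>
lemma nonneg_of_slip_when_negative:
  assumes u: "u \<in> BV_plus S" and t: "t \<in> BV_plus S" and law: "friction_law f S u t"
    and start: "0 \<le> u 0 $ 2"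
    and slip: "\<And>s. s \<in> {0..S} \<Longrightarrow> u s $ 2 < 0 \<Longrightarrow> t s $ 2 + f * t s $ 1 < 0"
    and s: "s \<in> {0..S}"
  shows "0 \<le> u s $ 2"
proof (rule ccontr)
  assume neg: "\<not> 0 \<le> u s $ 2"
  have S: "0 \<le> S" using s by simp
  note ut = BV_plus_nth[OF u, of 2]
  have mono: "0 \<le> stieltjes S (\<lambda>s. u s $ 2) A"
    if "A \<in> sets borel" "A \<subseteq> {0..S}" "\<And>r. r \<in> A \<Longrightarrow> u r $ 2 < 0" for A
    using that slip
    by (intro stieltjes_nonneg_of_friction_law[OF u t S law]) (auto simp: sets_restrict_space_iff)
  \<comment> \<open>\<open>s0\<close> is the supremum of the times up to \<open>s\<close> at which
    the tangential component is nonnegative; after it the component stays negative.\<close>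
  define P where "P = {r \<in> {0..s}. 0 \<le> u r $ 2}"
  define s0 where "s0 = Sup P"
  have "0 \<in> P" "P \<subseteq> {0..s}" using start s by (auto simp: P_def)
  then have s0: "0 \<le> s0" "s0 \<le> s" and upper: "\<And>r. r \<in> P \<Longrightarrow> r \<le> s0"
    unfolding s0_def by (auto intro!: cSup_upper cSup_least bdd_aboveI[of _ s])
  have after: "u r $ 2 < 0" if "s0 < r" "r \<le> s" for r
    using upper[of r] that s0 by (force simp: P_def)
  show False
  proof (cases "0 \<le> u s0 $ 2")
    case True
    \<comment> \<open>The entry into the negative region lies in the left-open interval, whose
      measure \<open>u s $ 2 - u s0 $ 2\<close> would be negative.\<close>
    have "0 \<le> stieltjes S (\<lambda>s. u s $ 2) {s0<..s}" using after s s0 by (intro mono) auto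
    then show False using stieltjes_Ioc[OF ut, of s0 s] s s0 True neg by simp
  next
    case False
    obtain l where l: "((\<lambda>x. u (clamp_to S x) $ 2) \<longlongrightarrow> l) (at_left s0)"
      using BV_plus_left_limit[OF ut S] by blast
    \<comment> \<open>Now the closed interval is used, so that its measure includes a jump at
      \<open>s0\<close>. Nonnegativity gives \<open>l \<le> u s $ 2 < 0\<close>, hence negative
      values just before \<open>s0\<close>, against its choice as a supremum.\<close>
    have "u r $ 2 < 0" if "r \<in> {s0..s}" for r
      using that after False by (cases "r = s0") auto
    then have "0 \<le> stieltjes S (\<lambda>s. u s $ 2) {s0..s}" using s s0 by (intro mono) auto
    then have "l < 0" using stieltjes_Icc[OF ut s0(1,2) _ l] s neg by simp
    then have "eventually (\<lambda>x. u (clamp_to S x) $ 2 < 0) (at_left s0)"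
      by (rule order_tendstoD(2)[OF l])
    then obtain y where y: "y < s0" "\<And>x. y < x \<Longrightarrow> x < s0 \<Longrightarrow> u (clamp_to S x) $ 2 < 0"
      by (subst (asm) eventually_at_left[of "s0 - 1"]) auto
    obtain r where r: "r \<in> P" "y < r"
      using less_cSupD[of P y] y(1) \<open>0 \<in> P\<close> by (auto simp: s0_def)
    then have "r < s0" "clamp_to S r = r"
      using upper[of r] False s by (auto simp: P_def clamp_to_def order_less_le)
    then show False using y(2)[of r] r by (simp add: P_def)
  qed
qed

theorem proposition3p6:
  fixes K :: "real^2^2" and f R :: real and F u :: "real \<Rightarrow> real^2"
  assumes K: "stiffness_matrix K" "0 < K $ 1 $ 2"
    and f: "0 \<le> f" "K $ 2 $ 2 / K $ 1 $ 2 \<le> f"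
    and R: "0 < R"
    and F: "\<And>s. s \<in> {0..1} \<Longrightarrow> F s = vector [s * R / f, s * R]"
      "\<And>s. s \<in> {1..2} \<Longrightarrow> F s = vector [R / f + (s - 1), R + (f + 1) * (s - 1)]"
    and u: "\<And>s. s \<in> {0..<1} \<Longrightarrow> u s = 0"
      "\<And>s. s \<in> {1..2} \<Longrightarrow> u s = vector
         [(R * (K $ 2 $ 2 / f - K $ 1 $ 2) + (K $ 2 $ 2 - K $ 1 $ 2 * (f + 1)) * (s - 1)) /
            (K $ 1 $ 1 * K $ 2 $ 2 - (K $ 1 $ 2)\<^sup>2),
          (R * (K $ 1 $ 1 - K $ 1 $ 2 / f) + (K $ 1 $ 1 * (f + 1) - K $ 1 $ 2) * (s - 1)) /
            (K $ 1 $ 1 * K $ 2 $ 2 - (K $ 1 $ 2)\<^sup>2)]"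
  shows "(\<exists>L. L-lipschitz_on {0..2} F) \<and>
    solves_quasi_static K f 2 F 0 u \<and>
    (\<forall>v. solves_quasi_static K f 2 F 0 v \<and> (\<forall>s\<in>{0..<1}. v s = 0) \<longrightarrow>
         (\<forall>s\<in>{0..2}. v s = u s))"
proof -

  \<comment> \<open>Signs of the free displacement on [1, 2]\<close>
  define a b c D where "a = K $ 1 $ 1" and "b = K $ 1 $ 2" and "c = K $ 2 $ 2"
    and "D = a * c - b\<^sup>2"
  note abc = a_def[symmetric] b_def[symmetric] c_def[symmetric] D_def[symmetric]
  note ent = stiffness_matrix_entries[OF K(1)]
  have b: "0 < b" and c: "0 < c" and D: "0 < D" "D = a * c - b\<^sup>2"
    using K(2) ent by (simp_all add: a_def b_def c_def D_def)
  have cfb: "c \<le> f * b" using f(2) b by (simp add: abc field_simps)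
  have f0: "0 < f" using cfb c b f(1) by (cases "f = 0") auto
  \<comment> \<open>The determinant and the lower bound on \<open>f\<close> combine to
    \<open>b * b < a * c \<le> a * f * b\<close>; the resulting \<open>b < a * f\<close> makes the
    free tangential displacement positive.\<close>
  have "b * b < a * c" using D by (simp add: power2_eq_square)
  moreover have a: "0 < a"
    using \<open>b * b < a * c\<close> c b by (smt (verit) mult_nonneg_nonneg mult_nonpos_nonneg)
  ultimately have "b * b < a * (f * b)" using mult_left_mono[OF cfb, of a] by linarith
  then have baf: "b < a * f" using b by (simp add: mult.assoc[symmetric])
  have u_eq: "u s = vector
      [(R * (c / f - b) + (c - b * (f + 1)) * (s - 1)) / D,
       (R * (a - b / f) + (a * (f + 1) - b) * (s - 1)) / D]" if "s \<in> {1..2}" for s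
    using u(2)[OF that] by (simp only: a_def b_def c_def D_def)
  \<comment> \<open>This equivalence serves twice: it makes the reaction of \<open>u\<close> vanish
    on [1, 2], and it identifies any reaction-free state there with \<open>u\<close>.\<close>
  have solve: "K *v w = F s \<longleftrightarrow> w = u s" if "s \<in> {1..2}" for s w
  proof -
    have "c * F s $ 1 - b * F s $ 2 = R * (c / f - b) + (c - b * (f + 1)) * (s - 1)"
      "a * F s $ 2 - b * F s $ 1 = R * (a - b / f) + (a * (f + 1) - b) * (s - 1)"
      by (simp_all add: F(2)[OF that] algebra_simps)
    then show ?thesis
      using symmetric_2x2_solve[OF ent(1), of w "F s"] D(1) by (simp add: abc u_eq[OF that])
  qed
  have u_n: "u s $ 1 \<le> 0" if "s \<in> {1..2}" for s
  proof -
    have "c / f - b \<le> 0" "c - b * (f + 1) \<le> 0"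
      using cfb f0 b by (auto simp: field_simps)
    then have "R * (c / f - b) + (c - b * (f + 1)) * (s - 1) \<le> 0"
      using R that by (intro add_nonpos_nonpos mult_nonneg_nonpos mult_nonpos_nonneg) auto
    then show ?thesis using D by (simp add: u_eq[OF that] divide_le_0_iff)
  qed
  have u_t: "0 < u s $ 2" if "s \<in> {1..2}" for s
  proof -
    have "0 < a - b / f" using baf f0 by (simp add: field_simps)
    moreover have "0 \<le> a * (f + 1) - b" using baf a by (simp add: algebra_simps)
    ultimately have "0 < R * (a - b / f) + (a * (f + 1) - b) * (s - 1)"
      using R that by (intro add_pos_nonneg mult_pos_pos mult_nonneg_nonneg) auto
    then show ?thesis using D by (simp add: u_eq[OF that])
  qed

  \<comment> \<open>Lipschitz continuity of the force\<close>
  define q1 q2 where "q1 = (vector [R / f, R] :: real^2)" and "q2 = (vector [1, f + 1] :: real^2)"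
  define L where "L = norm q1 + norm q2"
  have F1: "F s = 0 + s *\<^sub>R q1" if "s \<in> {0..1}" for s
    using F(1)[OF that] by (simp add: q1_def vec_eq_iff forall_2)
  have F2: "F s = (vector [R / f - 1, R - (f + 1)] + s *\<^sub>R q2)" if "s \<in> {1..2}" for s
    using F(2)[OF that] by (simp add: q2_def vec_eq_iff forall_2 algebra_simps)
  have "L-lipschitz_on {0..1} F" "L-lipschitz_on {1..2} F"
    by (rule lipschitz_on_affine[OF F1] lipschitz_on_affine[OF F2]; simp add: L_def)+
  from lipschitz_on_concat[OF this refl] have lip: "L-lipschitz_on {0..2} F" by simp

  \<comment> \<open>The given function is a solution\<close>
  have F_BV: "F \<in> BV_plus 2"
    using lip by (intro BV_plus_piecewise_lipschitz[of 0 2 L])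
      (auto intro: lipschitz_on_nonneg simp: lipschitz_on_def)
  have u_BV: "u \<in> BV_plus 2"
  proof (rule BV_plus_piecewise_lipschitz)
    define q where "q = (vector [(c - b * (f + 1)) / D, (a * (f + 1) - b) / D] :: real^2)"
    show "(norm q)-lipschitz_on {0..<1} u"
      using u(1) by (intro lipschitz_onI) auto
    show "(norm q)-lipschitz_on {1..2} u"
    proof (rule lipschitz_on_affine[OF _ order_refl])
      fix s :: real assume "s \<in> {1..2}"
      then show "u s = (u 1 - q) + s *\<^sub>R q"
        by (simp add: u_eq q_def vec_eq_iff forall_2 add_divide_distrib algebra_simps
            diff_divide_distrib)
    qed
  qed auto
  define t where "t s = K *v u s - F s" for s
  \<comment> \<open>With \<open>u = 0\<close> the reaction is \<open>- F s\<close>, which lies on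
    the forward edge of the cone, \<open>t s $ 2 = f * t s $ 1\<close>.\<close>
  have t1: "t s = 0 + s *\<^sub>R (- q1)" if "s \<in> {0..<1}" for s
    using that u(1)[OF that] F1[of s] by (simp add: t_def)
  have t2: "t s = 0" if "s \<in> {1..2}" for s
    using solve[OF that, of "u s"] by (simp add: t_def)
  have t_BV: "t \<in> BV_plus 2"
  proof (rule BV_plus_piecewise_lipschitz)
    show "(norm q1)-lipschitz_on {0..<1} t" by (rule lipschitz_on_affine[OF t1]) auto
    show "(norm q1)-lipschitz_on {1..2} t" using t2 by (intro lipschitz_onI) auto
  qed auto
  have law: "friction_law f 2 u t"
    by (rule friction_law_stick_then_free[OF u_BV, of 1]) (simp_all add: u(1) t2)
  have conditions: "K *v u s = F s + t s \<and> u s $ 1 \<le> 0 \<and> t s $ 1 \<le> 0 \<and> u s $ 1 * t s $ 1 = 0 \<and>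
      \<bar>t s $ 2\<bar> \<le> - f * t s $ 1" if "s \<in> {0..2}" for s
  proof (cases "s < 1")
    case True
    then show ?thesis
      using that u(1)[of s] t1[of s] R f0
      by (simp add: t_def[of s, symmetric] q1_def) (simp add: t_def)
  next
    case False
    then show ?thesis using that t2[of s] u_n[of s] by (simp add: t_def)
  qed
  have "admissible K f (F 0) 0"
    using conditions[of 0] u(1)[of 0] by (auto simp: admissible_def)
  then have sol: "solves_quasi_static K f 2 F 0 u"
    unfolding solves_quasi_static_def quasi_static_solution_def
    using F_BV u_BV t_BV law conditions u(1)[of 0] by (intro exI[of _ t]) auto

  \<comment> \<open>Uniqueness\<close>
  have unique: "v s = u s"
    if v: "solves_quasi_static K f 2 F 0 v" "\<forall>s\<in>{0..<1}. v s = 0" and s: "s \<in> {0..2}" for v s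
  proof -
    obtain t where v_BV: "v \<in> BV_plus 2" and t_BV: "t \<in> BV_plus 2" and law: "friction_law f 2 v t"
      and eq: "\<And>s. s \<in> {0..2} \<Longrightarrow> K *v v s = F s + t s"
      and contact: "\<And>s. s \<in> {0..2} \<Longrightarrow> v s $ 1 * t s $ 1 = 0"
        "\<And>s. s \<in> {0..2} \<Longrightarrow> \<bar>t s $ 2\<bar> \<le> - f * t s $ 1"
      using v(1) unfolding solves_quasi_static_def quasi_static_solution_def by blast
    have dich: "v r = u r \<or> (c < f * b \<and> (f * b - c) * v r $ 2 \<le> - (r - 1) \<and> t r $ 2 + f * t r $ 1 < 0)"
      if r: "r \<in> {1..2}" "1 < r \<or> c < f * b" for r
    proof -
      have "a * v r $ 1 + b * v r $ 2 = R / f + (r - 1) + t r $ 1"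
        "b * v r $ 1 + c * v r $ 2 = R + (f + 1) * (r - 1) + t r $ 2"
        using eq[of r] r(1) ent(1)
        by (simp_all add: vec_eq_iff forall_2 matrix_vector_mult_2 F(2)[OF r(1)] abc)
      from free_or_backward_contact[OF f0 cfb c R _ _ this contact(1)[of r] contact(2)[of r]] r
      have "(t r $ 1 = 0 \<and> t r $ 2 = 0) \<or>
          (c < f * b \<and> (f * b - c) * v r $ 2 \<le> - (r - 1) \<and> t r $ 2 + f * t r $ 1 < 0)"
        by auto
      moreover have "v r = u r" if "t r $ 1 = 0 \<and> t r $ 2 = 0"
        using solve[OF r(1), of "v r"] eq[of r] r(1) that by (simp add: vec_eq_iff forall_2)
      ultimately show ?thesis by blast
    qed
    have after: "v r = u r" if r: "r \<in> {1<..2}" for r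
    proof (rule ccontr)
      assume "v r \<noteq> u r"
      then have strict: "c < f * b" and "(f * b - c) * v r $ 2 \<le> - (r - 1)" using dich[of r] r by auto
      then have "(f * b - c) * v r $ 2 < 0" using r by simp
      then have neg: "v r $ 2 < 0" using strict by (simp add: mult_less_0_iff)
      have "0 \<le> v r $ 2"
      proof (rule nonneg_of_slip_when_negative[OF v_BV t_BV law])
        fix x assume x: "x \<in> {0..2}" "v x $ 2 < 0"
        \<comment> \<open>A negative state cannot occur before time 1, where \<open>v\<close>
          vanishes, nor can it equal \<open>u x\<close>, whose tangential component is positive; so
          the contact alternative of \<open>dich\<close> holds, also at \<open>x = 1\<close> thanks
          to \<open>strict\<close>.\<close>
        then have "1 \<le> x" using v(2) by (cases "x < 1") auto
        then show "t x $ 2 + f * t x $ 1 < 0"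
          using dich[of x] u_t[of x] x strict by auto
      qed (use v(2) r in auto)
      then show False using neg by simp
    qed
    consider "s < 1" | "s = 1" | "1 < s" by linarith
    then show ?thesis
    proof cases
      case 1
      then show ?thesis using s u(1) v(2) by simp
    next
      case 2
      \<comment> \<open>\<open>after\<close> leaves out time 1. Right-continuity of both functions
        carries the equality on \<open>{1<..2}\<close> back to it.\<close>
      have "(v \<longlongrightarrow> v 1) (at_right 1)" "(u \<longlongrightarrow> u 1) (at_right 1)"
        using v_BV u_BV by (auto simp: BV_plus_def continuous_within)
      moreover have "eventually (\<lambda>x. v x = u x) (at_right 1)"
        using eventually_at_right_real[of 1 2] after by (auto elim!: eventually_mono)
      ultimately have "(u \<longlongrightarrow> v 1) (at_right 1)" by (simp add: tendsto_cong)
      then show ?thesis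
        using tendsto_unique[OF _ _ \<open>(u \<longlongrightarrow> u 1) (at_right 1)\<close>] 2 by simp
    next
      case 3
      then show ?thesis using after s by simp
    qed
  qed
  show ?thesis using lip sol unique by blast
qed

end
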